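(* Let $A_n = A_n(h,T)$ be an apex tree, where $T$ is a tree. Then for every signature $\sigma : E(A_n) \to \{+1,-1\}$, $l(A_n,\sigma) = p^-(A_n,\sigma)$.
   Context: All graphs are finite, simple and undirected. A signed graph $\Sigma=(G,\sigma)$ is a graph $G$ with a signature $\sigma:E(G)\to\{+1,-1\}$. The sign of a cycle is the product of the signs of its edges; $\Sigma$ is balanced if all its cycles are positive. The frustration index $l(\Sigma)$ is the minimum number of edges whose deletion makes $\Sigma$ balanced. $p^-(\Sigma)$ is the maximum number of pairwise edge-disjoint negative cycles in $\Sigma$. Apex tree: $A_n(h,T)$ denotes a graph with a vertex $h$ of degree $n$ such that deleting $h$ leaves the tree $T$. Standing assumptions: all leaves of $T$ are neighbours of $h$; the graph is $2$-connected (the trivial case $A_1=K_2$ is allowed); and every vertex of degree $2$ in the graph is contained in a triangle. *)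

theory Defs
  imports Main
begin

record 'a ugraph =
  verts :: "'a set"
  edges :: "'a set set"

definition simple_graph :: "'a ugraph \<Rightarrow> bool" where
  "simple_graph G \<longleftrightarrow> finite (verts G) \<and> edges G \<subseteq> {e. e \<subseteq> verts G \<and> card e = 2}"

definition degree :: "'a ugraph \<Rightarrow> 'a \<Rightarrow> nat" where
  "degree G v = card {e \<in> edges G. v \<in> e}"

definition delete_vertex :: "'a ugraph \<Rightarrow> 'a \<Rightarrow> 'a ugraph" where
  "delete_vertex G v = \<lparr>verts = verts G - {v}, edges = {e \<in> edges G. v \<notin> e}\<rparr>"

definition delete_edges :: "'a ugraph \<Rightarrow> 'a set set \<Rightarrow> 'a ugraph" where
  "delete_edges G F = \<lparr>verts = verts G, edges = edges G - F\<rparr>"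

definition connected_graph :: "'a ugraph \<Rightarrow> bool" where
  "connected_graph G \<longleftrightarrow> verts G \<noteq> {} \<and>
     (\<forall>u\<in>verts G. \<forall>v\<in>verts G. (u, v) \<in> {(x, y). {x, y} \<in> edges G}\<^sup>*)"

definition two_connected :: "'a ugraph \<Rightarrow> bool" where
  "two_connected G \<longleftrightarrow> card (verts G) \<ge> 3 \<and> connected_graph G \<and>
     (\<forall>v\<in>verts G. connected_graph (delete_vertex G v))"

text \<open>A cycle is traversed by a list of distinct vertices, without repetition of the starting
  vertex at the end. As a subgraph, it is determined by its edge set, so cycles are counted
  by their edge sets.\<close>

definition cycle_edges :: "'a list \<Rightarrow> 'a set set" where
  "cycle_edges c = {{c ! i, c ! (Suc i mod length c)} | i. i < length c}"

definition is_cycle :: "'a ugraph \<Rightarrow> 'a list \<Rightarrow> bool" where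
  "is_cycle G c \<longleftrightarrow> length c \<ge> 3 \<and> distinct c \<and> cycle_edges c \<subseteq> edges G"

definition cycles :: "'a ugraph \<Rightarrow> 'a set set set" where
  "cycles G = {cycle_edges c | c. is_cycle G c}"

definition in_triangle :: "'a ugraph \<Rightarrow> 'a \<Rightarrow> bool" where
  "in_triangle G v \<longleftrightarrow> (\<exists>c. is_cycle G c \<and> length c = 3 \<and> v \<in> set c)"

definition is_tree :: "'a ugraph \<Rightarrow> bool" where
  "is_tree T \<longleftrightarrow> simple_graph T \<and> connected_graph T \<and> cycles T = {}"

definition is_leaf :: "'a ugraph \<Rightarrow> 'a \<Rightarrow> bool" where
  "is_leaf T v \<longleftrightarrow> v \<in> verts T \<and> degree T v = 1"

definition is_K2 :: "'a ugraph \<Rightarrow> bool" where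
  "is_K2 G \<longleftrightarrow> card (verts G) = 2 \<and> edges G = {verts G}"

definition apex_tree :: "nat \<Rightarrow> 'a \<Rightarrow> 'a ugraph \<Rightarrow> 'a ugraph \<Rightarrow> bool" where
  "apex_tree n h T A \<longleftrightarrow>
     simple_graph A \<and> h \<in> verts A \<and> degree A h = n \<and>
     delete_vertex A h = T \<and> is_tree T \<and>
     (\<forall>v. is_leaf T v \<longrightarrow> {h, v} \<in> edges A) \<and>
     (two_connected A \<or> is_K2 A) \<and>
     (\<forall>v\<in>verts A. degree A v = 2 \<longrightarrow> in_triangle A v)"

text \<open>A signature is only constrained on the edges of the graph; its values elsewhere are
  irrelevant to all notions below.\<close>

definition signature :: "'a ugraph \<Rightarrow> ('a set \<Rightarrow> int) \<Rightarrow> bool" where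
  "signature G \<sigma> \<longleftrightarrow> (\<forall>e\<in>edges G. \<sigma> e \<in> {1, -1})"

definition cycle_sign :: "('a set \<Rightarrow> int) \<Rightarrow> 'a set set \<Rightarrow> int" where
  "cycle_sign \<sigma> C = (\<Prod>e\<in>C. \<sigma> e)"

definition negative_cycles :: "'a ugraph \<Rightarrow> ('a set \<Rightarrow> int) \<Rightarrow> 'a set set set" where
  "negative_cycles G \<sigma> = {C \<in> cycles G. cycle_sign \<sigma> C = -1}"

definition balanced :: "'a ugraph \<Rightarrow> ('a set \<Rightarrow> int) \<Rightarrow> bool" where
  "balanced G \<sigma> \<longleftrightarrow> (\<forall>C\<in>cycles G. cycle_sign \<sigma> C = 1)"

definition frustration_index :: "'a ugraph \<Rightarrow> ('a set \<Rightarrow> int) \<Rightarrow> nat" where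
  "frustration_index G \<sigma> =
     Min {card F | F. F \<subseteq> edges G \<and> balanced (delete_edges G F) \<sigma>}"

definition negative_cycle_packing_number :: "'a ugraph \<Rightarrow> ('a set \<Rightarrow> int) \<Rightarrow> nat" where
  "negative_cycle_packing_number G \<sigma> =
     Max {card P | P. P \<subseteq> negative_cycles G \<sigma> \<and> pairwise disjnt P}"

end

(*
  Deleting h leaves a forest, so a cycle of the apex tree is a path of T closed up by two edges at h.
  Regard the edges at h as signed tokens placed on the vertices of T. Edge-disjoint negative cycles are
  then disjoint pairs of tokens joined by edge-disjoint paths of negative total sign, and a potential
  \<pi> : V(T) \<rightarrow> {1, -1}, extended by \<pi>(h) = 1, gives a balancing set: the frustrated edges and
  tokens. Equality of the optima follows by eliminating the leaves of T one at a time. Two opposite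
  tokens at one vertex form a pair; of several equal tokens at a leaf only one can leave through the
  pendant edge, so the others may be dropped; a single token is moved to the neighbour of the leaf,
  its sign being multiplied by the sign of the pendant edge.
*)

theory Submission
  imports Defs
begin

section \<open>Paths and cycles as sets of edges\<close>

fun path_edges :: "'a list \<Rightarrow> 'a set set" where
  "path_edges (u # v # p) = insert {u, v} (path_edges (v # p))"
| "path_edges _ = {}"

definition is_path :: "'a ugraph \<Rightarrow> 'a list \<Rightarrow> bool" where
  "is_path G p \<longleftrightarrow> p \<noteq> [] \<and> distinct p \<and> set p \<subseteq> verts G \<and> path_edges p \<subseteq> edges G"

lemma path_edges_Cons: "p \<noteq> [] \<Longrightarrow> path_edges (v # p) = insert {v, hd p} (path_edges p)"
  by (cases p) auto

lemma path_edges_snoc: "p \<noteq> [] \<Longrightarrow> path_edges (p @ [v]) = insert {last p, v} (path_edges p)"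
  by (induction p rule: path_edges.induct) auto

lemma finite_path_edges [simp]: "finite (path_edges p)"
  by (induction p rule: path_edges.induct) auto

lemma path_edges_subset_set: "e \<in> path_edges p \<Longrightarrow> e \<subseteq> set p"
  by (induction p rule: path_edges.induct) auto

lemma path_edges_conv_nth: "path_edges p = {{p ! i, p ! Suc i} | i. Suc i < length p}"
proof (induction p rule: path_edges.induct)
  case (1 u v p)
  have "{{(u # v # p) ! i, (u # v # p) ! Suc i} | i. Suc i < length (u # v # p)} =
      insert {u, v} {{(v # p) ! i, (v # p) ! Suc i} | i. Suc i < length (v # p)}" (is "?L = ?R")
  proof
    show "?L \<subseteq> ?R"
    proof
      fix e assume "e \<in> ?L"
      then obtain i where "e = {(u # v # p) ! i, (u # v # p) ! Suc i}" "Suc i < length (u # v # p)"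
        by blast
      then show "e \<in> ?R" by (cases i) auto
    qed
    show "?R \<subseteq> ?L"
    proof
      fix e assume "e \<in> ?R"
      then consider "e = {u, v}"
        | i where "e = {(v # p) ! i, (v # p) ! Suc i}" "Suc i < length (v # p)"
        by blast
      then show "e \<in> ?L"
      proof cases
        case 1
        then show ?thesis by (auto intro!: exI[of _ 0])
      next
        case (2 i)
        then show ?thesis by (auto intro!: exI[of _ "Suc i"])
      qed
    qed
  qed
  with 1 show ?case by simp
qed auto

lemma path_edges_take_subset: "path_edges (take k p) \<subseteq> path_edges p"
  by (auto simp: path_edges_conv_nth)

text \<open>The modulus wraps around only at the last index, so a cycle is a path plus one closing
  edge. Signs of cycles are computed in this form.\<close>

lemma cycle_edges_conv_path_edges:
  assumes "c \<noteq> []"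
  shows "cycle_edges c = insert {last c, hd c} (path_edges c)"
proof -
  have "{c ! i, c ! (Suc i mod length c)} \<in> insert {last c, hd c} (path_edges c)"
    if "i < length c" for i
  proof (cases "Suc i < length c")
    case True
    then show ?thesis by (auto simp: path_edges_conv_nth)
  next
    case False
    then have "length c = Suc i" using that by simp
    then show ?thesis using assms by (simp add: hd_conv_nth last_conv_nth)
  qed
  moreover have "{last c, hd c} \<in> cycle_edges c"
    using assms unfolding cycle_edges_def
    by (auto simp: hd_conv_nth last_conv_nth intro!: exI[of _ "length c - 1"])
  moreover have "path_edges c \<subseteq> cycle_edges c"
    unfolding path_edges_conv_nth cycle_edges_def by force
  ultimately show ?thesis unfolding cycle_edges_def by blast
qed

text \<open>The product ranges over a set, so the added edge must not be present already. It is new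
  because it contains \<open>v\<close>, while the edges of \<open>p\<close> lie within
  \<open>set p\<close>.\<close>

lemma prod_path_edges_Cons:
  assumes "p \<noteq> []" "v \<notin> set p"
  shows "(\<Prod>e\<in>path_edges (v # p). f e) = f {v, hd p} * (\<Prod>e\<in>path_edges p. f e)"
proof -
  have "{v, hd p} \<notin> path_edges p" using assms path_edges_subset_set by fastforce
  then show ?thesis using assms by (simp add: path_edges_Cons)
qed

lemma prod_path_edges_snoc:
  assumes "p \<noteq> []" "v \<notin> set p"
  shows "(\<Prod>e\<in>path_edges (p @ [v]). f e) = (\<Prod>e\<in>path_edges p. f e) * f {last p, v}"
proof -
  have "{last p, v} \<notin> path_edges p" using assms path_edges_subset_set by fastforce
  then show ?thesis using assms by (simp add: path_edges_snoc mult.commute)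
qed

text \<open>The only edge of the path at its head leads to the second vertex, and a list of at least
  three distinct vertices does not end there. With two vertices the closing edge would repeat the
  path edge.\<close>

lemma closing_edge_notin_path_edges:
  assumes "distinct c" "length c \<ge> 3"
  shows "{last c, hd c} \<notin> path_edges c"
proof -
  obtain a b d q where c: "c = a # b # d # q"
    using assms(2) by (metis Suc_le_length_iff numeral_3_eq_3)
  have "a \<notin> set (b # d # q)" using assms c by simp
  then have "{last c, a} \<notin> path_edges (b # d # q)" using path_edges_subset_set by fastforce
  moreover have "last c \<noteq> b" "last c \<noteq> a"
    using assms(1) c last_in_set[of "d # q"] by (auto split: if_splits)
  ultimately show ?thesis by (auto simp: c doubleton_eq_iff)
qed

section \<open>Potentials and balance\<close>

text \<open>The product telescopes: the potential of each inner vertex occurs twice and squares to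
  1. For a single vertex the empty product 1 is the square of its potential.\<close>

lemma prod_path_edges_potential:
  fixes \<pi> :: "'a \<Rightarrow> int"
  assumes "p \<noteq> []" "distinct p" "\<And>v. \<pi> v \<in> {1, -1}"
    and "\<And>e. e \<in> path_edges p \<Longrightarrow> \<sigma> e = prod \<pi> e"
  shows "(\<Prod>e\<in>path_edges p. \<sigma> e) = \<pi> (hd p) * \<pi> (last p)"
  using assms
proof (induction p rule: list_nonempty_induct)
  case (single x)
  show ?case using assms(3)[of x] by auto
next
  case (cons x p)
  then have "(\<Prod>e\<in>path_edges (x # p). \<sigma> e) = \<sigma> {x, hd p} * (\<Prod>e\<in>path_edges p. \<sigma> e)"
    by (intro prod_path_edges_Cons) auto
  also have "\<sigma> {x, hd p} = \<pi> x * \<pi> (hd p)"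
    using cons by (cases p) (auto simp: path_edges_Cons)
  also have "(\<Prod>e\<in>path_edges p. \<sigma> e) = \<pi> (hd p) * \<pi> (last p)"
    using cons by (simp add: path_edges_Cons)
  finally show ?case using cons.hyps assms(3)[of "hd p"] by auto
qed

text \<open>The easy direction of Harary's criterion: when a cycle is cut open at its closing edge,
  the path and the closing edge both have as sign the product of the potentials of the two
  ends.\<close>

lemma balanced_if_potential:
  fixes \<pi> :: "'a \<Rightarrow> int"
  assumes "\<And>v. \<pi> v \<in> {1, -1}" "\<And>e. e \<in> edges G \<Longrightarrow> \<sigma> e = prod \<pi> e"
  shows "balanced G \<sigma>"
  unfolding balanced_def
proof
  fix C assume "C \<in> cycles G"
  then obtain c where c: "C = cycle_edges c" "length c \<ge> 3" "distinct c" "cycle_edges c \<subseteq> edges G"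
    unfolding cycles_def is_cycle_def by blast
  then have ne: "c \<noteq> []" by auto
  note ce = cycle_edges_conv_path_edges[OF ne]
  \<comment> \<open>Equal ends would make the closing edge a singleton, and \<open>prod\<close>
    would supply one factor instead of two.\<close>
  have "hd c \<noteq> last c" using c(2,3) by (cases c) auto
  then have "\<sigma> {last c, hd c} = \<pi> (last c) * \<pi> (hd c)"
    using c(4) ce assms(2)[of "{last c, hd c}"] by auto
  moreover have "(\<Prod>e\<in>path_edges c. \<sigma> e) = \<pi> (hd c) * \<pi> (last c)"
    using c ce assms by (intro prod_path_edges_potential ne) auto
  ultimately show "cycle_sign \<sigma> C = 1"
    using closing_edge_notin_path_edges[OF c(3,2)] assms(1)[of "hd c"] assms(1)[of "last c"]
    unfolding cycle_sign_def c(1) ce by auto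
qed

section \<open>Vertices of degree at most one in forests\<close>

lemma cycles_mono: "edges G \<subseteq> edges H \<Longrightarrow> cycles G \<subseteq> cycles H"
  unfolding cycles_def is_cycle_def by blast

lemma simple_graph_delete_vertex: "simple_graph G \<Longrightarrow> simple_graph (delete_vertex G v)"
  unfolding simple_graph_def delete_vertex_def by auto

text \<open>The head of a longest path is such a vertex: a second neighbour of its head would close a cycle.\<close>

lemma forest_has_vertex_of_degree_le_1:
  assumes G: "simple_graph G" "cycles G = {}" and ne: "verts G \<noteq> {}"
  obtains v where "v \<in> verts G" "\<And>u w. {v, u} \<in> edges G \<Longrightarrow> {v, w} \<in> edges G \<Longrightarrow> u = w"
proof -
  let ?L = "{p. is_path G p}"
  have fin: "finite (verts G)" using G by (simp add: simple_graph_def)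
  obtain v0 where "v0 \<in> verts G" using ne by blast
  then have "is_path G [v0]" by (simp add: is_path_def)
  moreover have "length p < Suc (card (verts G))" if "is_path G p" for p
    using that fin by (metis card_mono distinct_card is_path_def less_Suc_eq_le)
  ultimately obtain p where p: "is_path G p" and max: "\<And>q. is_path G q \<Longrightarrow> length q \<le> length p"
    using ex_has_greatest_nat[of "is_path G" "[v0]" length "Suc (card (verts G))"] by metis
  obtain v q where vq: "p = v # q" using p by (cases p) (auto simp: is_path_def)
  have edge: "u \<in> verts G \<and> u \<noteq> v" if "{v, u} \<in> edges G" for u
    using G that by (auto simp: simple_graph_def)
  have in_q: "u \<in> set q" if "{v, u} \<in> edges G" for u
  proof (rule ccontr)
    assume "u \<notin> set q"
    then have "is_path G (u # p)"
      using p vq edge[OF that] that by (auto simp: is_path_def insert_commute)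
    then show False using max by fastforce
  qed
  have hd_q: "u = hd q" if u: "{v, u} \<in> edges G" for u
  proof (rule ccontr)
    assume "u \<noteq> hd q"
    obtain i where i: "i < length q" "q ! i = u" using in_q[OF u] by (auto simp: in_set_conv_nth)
    with \<open>u \<noteq> hd q\<close> have "i > 0" by (cases i) (auto simp: hd_conv_nth)
    \<comment> \<open>The segment of \<open>p\<close> from \<open>v\<close> to \<open>u\<close>.
      Since \<open>u\<close> has index \<open>Suc i\<close> in \<open>p\<close>, it consists of
      \<open>Suc (Suc i)\<close> vertices, at least three by \<open>i > 0\<close>; the edge between
      \<open>v\<close> and \<open>u\<close> closes it to a cycle.\<close>
    define c where "c = take (Suc (Suc i)) p"
    have c: "c \<noteq> []" "hd c = v" "last c = u" "length c \<ge> 3" "distinct c"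
      using p i \<open>i > 0\<close> by (auto simp: c_def vq is_path_def last_conv_nth dest: in_set_takeD)
    have "path_edges c \<subseteq> edges G"
      using p path_edges_take_subset[of "Suc (Suc i)" p] by (auto simp: c_def is_path_def)
    then have "is_cycle G c"
      using c u by (simp add: is_cycle_def cycle_edges_conv_path_edges insert_commute)
    then show False using G(2) by (auto simp: cycles_def)
  qed
  show thesis
    using that[of v] p vq hd_q by (auto simp: is_path_def)
qed

section \<open>Signed tokens, links and frustration\<close>

text \<open>A token \<open>x :: 'b\<close> sits at the vertex \<open>loc x\<close>, with sign \<open>\<tau> x\<close>; several tokens may share a
  vertex. A link \<open>(x, p, y)\<close> joins two tokens by a path \<open>p\<close>, and its support consists of the
  resources it uses up.\<close>

fun support :: "'b \<times> 'a list \<times> 'b \<Rightarrow> ('b + 'a set) set" where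
  "support (x, p, y) = {Inl x, Inl y} \<union> Inr ` path_edges p"

fun negative_link ::
  "'a ugraph \<Rightarrow> ('a set \<Rightarrow> int) \<Rightarrow> 'b set \<Rightarrow> ('b \<Rightarrow> 'a) \<Rightarrow> ('b \<Rightarrow> int) \<Rightarrow> 'b \<times> 'a list \<times> 'b \<Rightarrow> bool"
where
  "negative_link G \<sigma> X loc \<tau> (x, p, y) \<longleftrightarrow>
     x \<in> X \<and> y \<in> X \<and> x \<noteq> y \<and> is_path G p \<and> hd p = loc x \<and> last p = loc y \<and>
     \<tau> x * (\<Prod>e\<in>path_edges p. \<sigma> e) * \<tau> y = -1"

definition linkage ::
  "'a ugraph \<Rightarrow> ('a set \<Rightarrow> int) \<Rightarrow> 'b set \<Rightarrow> ('b \<Rightarrow> 'a) \<Rightarrow> ('b \<Rightarrow> int) \<Rightarrow> ('b \<times> 'a list \<times> 'b) set \<Rightarrow> bool"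
where
  "linkage G \<sigma> X loc \<tau> M \<longleftrightarrow> finite M \<and> (\<forall>m\<in>M. negative_link G \<sigma> X loc \<tau> m) \<and>
     pairwise (\<lambda>m m'. disjnt (support m) (support m')) M"

text \<open>\<open>prod \<pi> e\<close> is the product of the potentials of the two ends, so these
  are the edges that are negative after switching by \<open>\<pi>\<close>.\<close>

definition frustrated_edges :: "'a ugraph \<Rightarrow> ('a set \<Rightarrow> int) \<Rightarrow> ('a \<Rightarrow> int) \<Rightarrow> 'a set set" where
  "frustrated_edges G \<sigma> \<pi> = {e \<in> edges G. \<sigma> e \<noteq> prod \<pi> e}"

text \<open>A token stands for an edge to an apex of potential 1; such an edge is frustrated when
  its sign differs from the potential at its other end.\<close>

definition frustrated_tokens :: "'b set \<Rightarrow> ('b \<Rightarrow> 'a) \<Rightarrow> ('b \<Rightarrow> int) \<Rightarrow> ('a \<Rightarrow> int) \<Rightarrow> 'b set" where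
  "frustrated_tokens X loc \<tau> \<pi> = {x \<in> X. \<tau> x \<noteq> \<pi> (loc x)}"

lemma is_path_mono: "is_path G p \<Longrightarrow> verts G \<subseteq> verts H \<Longrightarrow> edges G \<subseteq> edges H \<Longrightarrow> is_path H p"
  unfolding is_path_def by blast

lemma linkage_mono:
  assumes "linkage G \<sigma> X loc \<tau> M" "verts G \<subseteq> verts H" "edges G \<subseteq> edges H" "X \<subseteq> Y"
  shows "linkage H \<sigma> Y loc \<tau> M"
proof -
  have "negative_link H \<sigma> Y loc \<tau> m" if "negative_link G \<sigma> X loc \<tau> m" for m
    using that assms(2-4) is_path_mono by (cases m) fastforce
  then show ?thesis using assms(1) unfolding linkage_def by blast
qed

text \<open>The potential at the common vertex agrees with exactly one of two opposite signs, so the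
  pair costs one. The link gained in \<open>linkage_insert_pair\<close> pays for it.\<close>

lemma frustrated_tokens_at_opposite_pair:
  assumes "finite X" "x \<in> X" "y \<in> X" "loc x = loc y" "\<tau> x \<noteq> \<tau> y" "\<tau> x \<in> {1, -1}" "\<tau> y \<in> {1, -1}"
    and "\<And>v. \<pi> v \<in> {1, -1::int}"
  shows "card (frustrated_tokens X loc \<tau> \<pi>) \<le> Suc (card (frustrated_tokens (X - {x, y}) loc \<tau> \<pi>))"
proof -
  let ?F = "frustrated_tokens (X - {x, y}) loc \<tau> \<pi>"
  define z where "z = (if \<tau> x = \<pi> (loc x) then y else x)"
  have "frustrated_tokens X loc \<tau> \<pi> \<subseteq> insert z ?F"
    using assms(4-7) assms(8)[of "loc x"] unfolding frustrated_tokens_def z_def by auto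
  moreover have "finite ?F"
    using assms(1) by (simp add: frustrated_tokens_def)
  ultimately have "card (frustrated_tokens X loc \<tau> \<pi>) \<le> card (insert z ?F)"
    by (intro card_mono) auto
  also have "\<dots> \<le> Suc (card ?F)" by (simp add: card_insert_le_m1)
  finally show ?thesis .
qed

text \<open>The one-vertex path has no edges, so the new link uses up only the tokens
  \<open>x\<close> and \<open>y\<close>, which \<open>M\<close> leaves free.\<close>

lemma linkage_insert_pair:
  assumes "linkage G \<sigma> (X - {x, y}) loc \<tau> M" "x \<in> X" "y \<in> X" "loc x = loc y" "loc x \<in> verts G"
    and "\<tau> x * \<tau> y = -1"
  shows "linkage G \<sigma> X loc \<tau> (insert (x, [loc x], y) M)" "(x, [loc x], y) \<notin> M"
proof -
  have M: "finite M" "pairwise (\<lambda>m m'. disjnt (support m) (support m')) M"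
    "\<And>m. m \<in> M \<Longrightarrow> negative_link G \<sigma> (X - {x, y}) loc \<tau> m"
    using assms(1) by (auto simp: linkage_def)
  show "(x, [loc x], y) \<notin> M" using M(3) by fastforce
  have "x \<noteq> y"
  proof
    assume "x = y"
    then show False using assms(6) zero_le_square[of "\<tau> y"] by simp
  qed
  then have "negative_link G \<sigma> X loc \<tau> (x, [loc x], y)"
    using assms by (simp add: is_path_def)
  moreover have "disjnt (support (x, [loc x], y)) (support m)" if "m \<in> M" for m
    using M(3)[OF that] by (cases m) (auto simp: disjnt_def)
  moreover have "linkage G \<sigma> X loc \<tau> M"
    using linkage_mono[OF assms(1)] by blast
  ultimately show "linkage G \<sigma> X loc \<tau> (insert (x, [loc x], y) M)"
    unfolding linkage_def by (auto simp: pairwise_insert disjnt_sym)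
qed

text \<open>The remaining edges avoid \<open>v\<close>, so the potential at \<open>v\<close> can be
  chosen afterwards, when the vertex is put back.\<close>

lemma frustrated_edges_upd_delete_vertex:
  "frustrated_edges (delete_vertex G v) \<sigma> (\<pi>(v := s)) = frustrated_edges (delete_vertex G v) \<sigma> \<pi>"
proof -
  have "prod (\<pi>(v := s)) e = prod \<pi> e" if "e \<in> edges (delete_vertex G v)" for e
    using that by (intro prod.cong) (auto simp: delete_vertex_def)
  then show ?thesis
    unfolding frustrated_edges_def by (intro Collect_cong) metis
qed

text \<open>Undoes the move of a token from \<open>v\<close> to \<open>w\<close>: the link that uses
  it is prolonged by the edge \<open>{v, w}\<close>, whose sign passes from the token to the path.
  With at most one token at \<open>v\<close>, no two links claim this edge.\<close>

lemma linkage_extend_at_leaf: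
  assumes M: "linkage (delete_vertex G v) \<sigma> X
      (\<lambda>x. if loc x = v then w else loc x) (\<lambda>x. if loc x = v then \<tau> x * \<sigma> {v, w} else \<tau> x) M"
    and vw: "v \<in> verts G" "{v, w} \<in> edges G"
    and uniq: "\<And>x y. x \<in> X \<Longrightarrow> y \<in> X \<Longrightarrow> loc x = v \<Longrightarrow> loc y = v \<Longrightarrow> x = y"
  obtains N where "linkage G \<sigma> X loc \<tau> N" "card N = card M"
proof -
  define T' where "T' = delete_vertex G v"
  define loc' where "loc' = (\<lambda>x. if loc x = v then w else loc x)"
  define \<tau>' where "\<tau>' = (\<lambda>x. if loc x = v then \<tau> x * \<sigma> {v, w} else \<tau> x)"
  define ext where "ext = (\<lambda>(x, p, y).
    (x, (if loc x = v then [v] else []) @ p @ (if loc y = v then [v] else []), y))"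
  have fin: "finite M" and pw: "pairwise (\<lambda>m m'. disjnt (support m) (support m')) M"
    and link: "\<And>m. m \<in> M \<Longrightarrow> negative_link T' \<sigma> X loc' \<tau>' m"
    using M by (auto simp: linkage_def T'_def loc'_def \<tau>'_def)
  \<comment> \<open>Prolonging adds at most the edge \<open>{v, w}\<close> to the support, and only
    if an end sits at \<open>v\<close>. That edge was free before, since the paths of
    \<open>M\<close> avoid \<open>v\<close>.\<close>
  have ext: "negative_link G \<sigma> X loc \<tau> (ext (x, p, y)) \<and>
      support (ext (x, p, y)) \<subseteq> support (x, p, y) \<union> (if loc x = v \<or> loc y = v then {Inr {v, w}} else {}) \<and>
      Inr {v, w} \<notin> support (x, p, y)"
    if m: "(x, p, y) \<in> M" for x p y
  proof -
    have l: "x \<in> X" "y \<in> X" "x \<noteq> y" "is_path T' p" "hd p = loc' x" "last p = loc' y"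
      "\<tau>' x * (\<Prod>e\<in>path_edges p. \<sigma> e) * \<tau>' y = -1"
      using link[OF m] by auto
    have p: "is_path G p" "p \<noteq> []" "v \<notin> set p"
      using l(4) by (auto simp: is_path_def T'_def delete_vertex_def)
    have "{v, w} \<notin> path_edges p" using p(3) path_edges_subset_set by fastforce
    then have new: "Inr {v, w} \<notin> support (x, p, y)" by auto
    \<comment> \<open>The two ends are different tokens, so they cannot both sit at
      \<open>v\<close>.\<close>
    consider "loc x = v" "loc y \<noteq> v" | "loc x \<noteq> v" "loc y = v" | "loc x \<noteq> v" "loc y \<noteq> v"
      using uniq l(1-3) by blast
    then show ?thesis
    proof cases
      case 1
      then have hd: "hd p = w" and last: "last p = loc y"
        and sign: "\<tau> x * (\<sigma> {v, w} * (\<Prod>e\<in>path_edges p. \<sigma> e)) * \<tau> y = -1"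
        using l(5-7) by (simp_all add: loc'_def \<tau>'_def mult.assoc)
      have "is_path G (v # p)"
        using p vw hd by (auto simp: is_path_def path_edges_Cons)
      moreover have "ext (x, p, y) = (x, v # p, y)" using 1 by (simp add: ext_def)
      ultimately have "negative_link G \<sigma> X loc \<tau> (ext (x, p, y))"
        using l(1-3) sign last p hd 1 by (simp add: prod_path_edges_Cons)
      moreover have "support (ext (x, p, y)) = insert (Inr {v, w}) (support (x, p, y))"
        using 1 p(2) hd by (auto simp: ext_def path_edges_Cons)
      ultimately show ?thesis using 1 new by auto
    next
      case 2
      then have last: "last p = w" and hd: "hd p = loc x"
        and sign: "\<tau> x * ((\<Prod>e\<in>path_edges p. \<sigma> e) * \<sigma> {w, v}) * \<tau> y = -1"
        using l(5-7) by (simp_all add: loc'_def \<tau>'_def insert_commute ac_simps)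
      have "is_path G (p @ [v])"
        using p vw last by (auto simp: is_path_def path_edges_snoc insert_commute)
      moreover have "ext (x, p, y) = (x, p @ [v], y)" using 2 by (simp add: ext_def)
      ultimately have "negative_link G \<sigma> X loc \<tau> (ext (x, p, y))"
        using l(1-3) sign last p hd 2 by (simp add: prod_path_edges_snoc)
      moreover have "support (ext (x, p, y)) = insert (Inr {v, w}) (support (x, p, y))"
        using 2 p(2) last by (auto simp: ext_def path_edges_snoc insert_commute)
      ultimately show ?thesis using 2 new by auto
    next
      case 3
      then show ?thesis using l p new by (auto simp: ext_def loc'_def \<tau>'_def)
    qed
  qed
  \<comment> \<open>\<open>ext\<close> keeps the tokens of a link. Hence two links with the same
    image would share a token, against the disjointness of their supports.\<close>
  have fst_ext: "Inl (fst (ext m)) \<in> support m" for m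
    by (cases m) (auto simp: ext_def)
  have "inj_on ext M"
  proof (rule inj_onI, rule ccontr)
    fix m m' assume "m \<in> M" "m' \<in> M" "ext m = ext m'" "m \<noteq> m'"
    moreover from this have "disjnt (support m) (support m')"
      using pw by (simp add: pairwise_def)
    ultimately show False
      using fst_ext[of m] fst_ext[of m'] unfolding disjnt_iff by metis
  qed
  then have "card (ext ` M) = card M" by (rule card_image)
  moreover have "disjnt (support (ext m)) (support (ext m'))"
    if mm: "m \<in> M" "m' \<in> M" "m \<noteq> m'" for m m'
  proof -
    obtain x p y x' p' y' where eq: "m = (x, p, y)" "m' = (x', p', y')"
      by (cases m, cases m') auto
    have d: "disjnt (support m) (support m')" using pw mm by (auto simp: pairwise_def)
    have X: "x \<in> X" "y \<in> X" "x' \<in> X" "y' \<in> X" using link mm eq by force+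
    have ne: "x \<noteq> x'" "x \<noteq> y'" "y \<noteq> x'" "y \<noteq> y'" using d eq by (auto simp: disjnt_iff)
    \<comment> \<open>Different links use different tokens, so at most one of the two gains the edge
      \<open>{v, w}\<close>.\<close>
    have "\<not> ((loc x = v \<or> loc y = v) \<and> (loc x' = v \<or> loc y' = v))"
      using uniq X ne by blast
    then consider "\<not> (loc x = v \<or> loc y = v)" | "\<not> (loc x' = v \<or> loc y' = v)" by blast
    then show ?thesis
      using d ext[OF mm(1)[unfolded eq]] ext[OF mm(2)[unfolded eq]]
      unfolding eq disjnt_def by cases (simp_all del: support.simps split: if_splits, blast+)
  qed
  then have "pairwise (\<lambda>m m'. disjnt (support m) (support m')) (ext ` M)"
    by (intro pairwise_imageI) blast
  moreover have "negative_link G \<sigma> X loc \<tau> m" if "m \<in> ext ` M" for m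
    using that ext by auto
  ultimately show thesis
    using that[of "ext ` M"] fin by (auto simp: linkage_def)
qed

section \<open>Min-max equality for tokens on a forest\<close>

text \<open>Forests with any number of tokens at a vertex form a class that is closed under deleting
  a vertex and moving its tokens. The induction is on vertices plus tokens, because some steps
  remove tokens only. The linkage and the potential are built together; the opposite inequality is
  supplied for cycles by \<open>packing_le_balancing\<close>.\<close>

lemma forest_linkage_min_max:
  fixes \<tau> :: "'b \<Rightarrow> int"
  assumes "simple_graph T" "cycles T = {}" "\<sigma> ` edges T \<subseteq> {1, -1}"
    and "finite X" "loc ` X \<subseteq> verts T" "\<tau> ` X \<subseteq> {1, -1}"
  obtains M \<pi> where "linkage T \<sigma> X loc \<tau> M" "\<And>v. \<pi> v \<in> {1, -1}"
    "card (frustrated_edges T \<sigma> \<pi>) + card (frustrated_tokens X loc \<tau> \<pi>) \<le> card M"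
proof -
  have "\<exists>M \<pi>. linkage T \<sigma> X loc \<tau> M \<and> (\<forall>v. \<pi> v \<in> {1, -1}) \<and>
      card (frustrated_edges T \<sigma> \<pi>) + card (frustrated_tokens X loc \<tau> \<pi>) \<le> card M"
    using assms
  proof (induction "card (verts T) + card X" arbitrary: T X loc \<tau> rule: less_induct)
    case (less T X loc \<tau>)
    note T = less.prems(1,2) and X = less.prems(4,5)
    have \<sigma>: "\<sigma> e \<in> {1, -1}" if "e \<in> edges T" for e using less.prems(3) that by blast
    have \<tau>: "\<tau> x \<in> {1, -1}" if "x \<in> X" for x using less.prems(6) that by blast
    have finT: "finite (verts T)" using T by (simp add: simple_graph_def)
    have "finite (edges T)"
      using T(1) finT by (auto simp: simple_graph_def intro: finite_subset[of _ "Pow (verts T)"])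
    then have fin_fr: "finite (frustrated_edges T \<sigma> \<pi>)" for \<pi>
      by (simp add: frustrated_edges_def)
    \<comment> \<open>Once no opposite pair is left, all tokens at a vertex have the same sign,
      which the elimination of a vertex relies on.\<close>
    consider (empty) "verts T = {}"
      | (pair) x y where "x \<in> X" "y \<in> X" "loc x = loc y" "\<tau> x \<noteq> \<tau> y"
      | (vertex) "verts T \<noteq> {}"
          "\<And>x y. x \<in> X \<Longrightarrow> y \<in> X \<Longrightarrow> loc x = loc y \<Longrightarrow> \<tau> x = \<tau> y"
      by blast
    then show ?case
    proof cases
      case empty
      then have "X = {}" "edges T = {}" using T X by (auto simp: simple_graph_def)
      then show ?thesis
        by (auto simp: linkage_def frustrated_edges_def frustrated_tokens_def
            intro!: exI[of _ "{}"] exI[of _ "\<lambda>_. 1"])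
    next
      case (pair x y)
      have "X - {x, y} \<subset> X" using pair by blast
      then have "card (X - {x, y}) < card X" using X by (intro psubset_card_mono)
      then have less: "card (verts T) + card (X - {x, y}) < card (verts T) + card X" by simp
      have X': "finite (X - {x, y})" "loc ` (X - {x, y}) \<subseteq> verts T" "\<tau> ` (X - {x, y}) \<subseteq> {1, -1}"
        using X less.prems(6) by auto
      obtain M \<pi> where M: "linkage T \<sigma> (X - {x, y}) loc \<tau> M" and \<pi>: "\<And>v. \<pi> v \<in> {1, -1}"
        and le: "card (frustrated_edges T \<sigma> \<pi>) +
          card (frustrated_tokens (X - {x, y}) loc \<tau> \<pi>) \<le> card M"
        using less.hyps[OF less T less.prems(3) X']
        by (elim exE conjE) (rule that, assumption, erule spec, assumption)
      have "\<tau> x * \<tau> y = -1" using pair \<tau>[of x] \<tau>[of y] by auto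
      then have "linkage T \<sigma> X loc \<tau> (insert (x, [loc x], y) M)" "(x, [loc x], y) \<notin> M"
        using linkage_insert_pair[OF M] pair X by auto
      moreover have "finite M" using M by (simp add: linkage_def)
      moreover have "card (frustrated_tokens X loc \<tau> \<pi>) \<le>
          Suc (card (frustrated_tokens (X - {x, y}) loc \<tau> \<pi>))"
        using X pair \<tau> \<pi> by (intro frustrated_tokens_at_opposite_pair) auto
      ultimately show ?thesis using le \<pi>
        by (intro exI[of _ "insert (x, [loc x], y) M"] exI[of _ \<pi>]) auto
    next
      case vertex
      obtain v where v: "v \<in> verts T"
        "\<And>u w. {v, u} \<in> edges T \<Longrightarrow> {v, w} \<in> edges T \<Longrightarrow> u = w"
        using forest_has_vertex_of_degree_le_1[OF T vertex(1)] by blast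
      define T' where "T' = delete_vertex T v"
      have T': "simple_graph T'" "cycles T' = {}" "verts T' = verts T - {v}"
        "edges T' = {e \<in> edges T. v \<notin> e}"
        using T simple_graph_delete_vertex cycles_mono[of T' T]
        by (auto simp: T'_def delete_vertex_def)
      have \<sigma>': "\<sigma> ` edges T' \<subseteq> {1, -1}" using less.prems(3) T'(4) by blast
      have card_T': "card (verts T') < card (verts T)"
        using v(1) finT T'(3) by (metis card_Diff1_less)
      have edge_at_v: "\<exists>u. u \<noteq> v \<and> e = {v, u}" if "e \<in> edges T" "v \<in> e" for e
        using T(1) that by (auto simp: simple_graph_def card_2_iff)
      have unique_edge: "e = {v, w}" if e: "e \<in> edges T" "v \<in> e" and w: "{v, w} \<in> edges T" for e w
      proof -
        obtain u where "e = {v, u}" using edge_at_v[OF e] by metis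
        then show ?thesis using v(2)[of u w] e w by simp
      qed
      \<comment> \<open>The case \<open>one\<close> also covers a vertex \<open>v\<close> without
        tokens; then only the potential at \<open>v\<close> has to be chosen.\<close>
      consider (isolated) "edges T' = edges T"
        | (many) w x x' where "{v, w} \<in> edges T" "w \<noteq> v"
            "x \<in> X" "x' \<in> X" "x \<noteq> x'" "loc x = v" "loc x' = v"
        | (one) w where "{v, w} \<in> edges T" "w \<noteq> v"
            "\<And>x y. x \<in> X \<Longrightarrow> y \<in> X \<Longrightarrow> loc x = v \<Longrightarrow> loc y = v \<Longrightarrow> x = y"
      proof (cases "edges T' = edges T")
        case False
        then obtain e where "e \<in> edges T" "v \<in> e" using T'(4) by blast
        with edge_at_v obtain w where "{v, w} \<in> edges T" "w \<noteq> v" by metis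
        then show ?thesis using many one by metis
      qed (rule isolated)
      then show ?thesis
      proof cases
        case isolated
        define X' where "X' = {x \<in> X. loc x \<noteq> v}"
        have "card X' \<le> card X" using X by (intro card_mono) (auto simp: X'_def)
        then have less: "card (verts T') + card X' < card (verts T) + card X"
          using card_T' by simp
        have X': "finite X'" "loc ` X' \<subseteq> verts T'" "\<tau> ` X' \<subseteq> {1, -1}"
          using X less.prems(6) T'(3) by (auto simp: X'_def)
        obtain M \<pi> where M: "linkage T' \<sigma> X' loc \<tau> M" and \<pi>: "\<And>u. \<pi> u \<in> {1, -1}"
          and le: "card (frustrated_edges T' \<sigma> \<pi>) + card (frustrated_tokens X' loc \<tau> \<pi>) \<le> card M"
          using less.hyps[OF less T'(1,2) \<sigma>' X']
          by (elim exE conjE) (rule that, assumption, erule spec, assumption)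
        obtain s where s: "s \<in> {1, -1}" "\<And>x. x \<in> X \<Longrightarrow> loc x = v \<Longrightarrow> \<tau> x = s"
          using vertex(2) \<tau> by (metis insertI1)
        define \<pi>' where "\<pi>' = \<pi>(v := s)"
        have "frustrated_tokens X loc \<tau> \<pi>' = frustrated_tokens X' loc \<tau> \<pi>"
          using s by (auto simp: frustrated_tokens_def \<pi>'_def X'_def)
        moreover have "frustrated_edges T \<sigma> \<pi>' = frustrated_edges T' \<sigma> \<pi>"
          using frustrated_edges_upd_delete_vertex[of T v \<sigma> \<pi> s] isolated
          unfolding T'_def \<pi>'_def by (simp add: frustrated_edges_def)
        moreover have "linkage T \<sigma> X loc \<tau> M"
          using linkage_mono[OF M] T' by (auto simp: X'_def)
        moreover have "\<pi>' u \<in> {1, -1}" for u using s(1) \<pi> by (simp add: \<pi>'_def)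
        ultimately show ?thesis using le by metis
      next
        case (many w x x')
        \<comment> \<open>The linkage obtained without \<open>x'\<close> is kept unchanged. What
          remains is to put \<open>x'\<close> back without raising the cost, possibly after changing
          the potential at \<open>v\<close>.\<close>
        define X' where "X' = X - {x'}"
        have "card X' < card X" unfolding X'_def using X(1) many(4) by (rule card_Diff1_less)
        then have less: "card (verts T) + card X' < card (verts T) + card X" by simp
        have X': "finite X'" "loc ` X' \<subseteq> verts T" "\<tau> ` X' \<subseteq> {1, -1}"
          using X less.prems(6) by (auto simp: X'_def)
        obtain M \<pi> where M: "linkage T \<sigma> X' loc \<tau> M" and \<pi>: "\<And>u. \<pi> u \<in> {1, -1}"
          and le: "card (frustrated_edges T \<sigma> \<pi>) + card (frustrated_tokens X' loc \<tau> \<pi>) \<le> card M"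
          using less.hyps[OF less T less.prems(3) X']
          by (elim exE conjE) (rule that, assumption, erule spec, assumption)
        have M': "linkage T \<sigma> X loc \<tau> M" using linkage_mono[OF M] by (auto simp: X'_def)
        have eq: "\<tau> y = \<tau> x" if "y \<in> X" "loc y = v" for y
          using vertex(2) that many by metis
        show ?thesis
        proof (cases "\<pi> v = \<tau> x")
          case True
          then have "frustrated_tokens X loc \<tau> \<pi> = frustrated_tokens X' loc \<tau> \<pi>"
            using eq[OF many(4,7)] many(7) by (auto simp: frustrated_tokens_def X'_def)
          then show ?thesis using M' \<pi> le by metis
        next
          case False
          \<comment> \<open>With the new value at \<open>v\<close> the kept token \<open>x\<close>
            is no longer frustrated. This saving pays for \<open>{v, w}\<close>, the only edge whose
            status can change.\<close>
          define \<pi>' where "\<pi>' = \<pi>(v := \<tau> x)"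
          have "y \<in> frustrated_tokens X' loc \<tau> \<pi>" if "y \<in> frustrated_tokens X loc \<tau> \<pi>'" for y
          proof -
            have y: "y \<in> X" "\<tau> y \<noteq> \<pi>' (loc y)" using that by (auto simp: frustrated_tokens_def)
            then have "loc y \<noteq> v" using eq by (auto simp: \<pi>'_def)
            then show ?thesis using y many(7) by (auto simp: frustrated_tokens_def X'_def \<pi>'_def)
          qed
          moreover have "x \<in> frustrated_tokens X' loc \<tau> \<pi>"
            using False many(3,5,6) by (simp add: frustrated_tokens_def X'_def)
          ultimately have "insert x (frustrated_tokens X loc \<tau> \<pi>') \<subseteq> frustrated_tokens X' loc \<tau> \<pi>"
            by blast
          moreover have "x \<notin> frustrated_tokens X loc \<tau> \<pi>'"
            using many by (simp add: frustrated_tokens_def \<pi>'_def)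
          moreover have "finite (frustrated_tokens X loc \<tau> \<pi>')" "finite (frustrated_tokens X' loc \<tau> \<pi>)"
            using X by (auto simp: frustrated_tokens_def X'_def)
          ultimately have "Suc (card (frustrated_tokens X loc \<tau> \<pi>')) \<le>
              card (frustrated_tokens X' loc \<tau> \<pi>)"
            by (metis card_insert_disjoint card_mono)
          moreover have "frustrated_edges T \<sigma> \<pi>' \<subseteq> insert {v, w} (frustrated_edges T \<sigma> \<pi>)"
          proof
            fix e assume e: "e \<in> frustrated_edges T \<sigma> \<pi>'"
            show "e \<in> insert {v, w} (frustrated_edges T \<sigma> \<pi>)"
            proof (cases "v \<in> e")
              case True
              then have "e = {v, w}"
                using e many(1) by (intro unique_edge) (auto simp: frustrated_edges_def)
              then show ?thesis by simp
            next
              case False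
              then have "prod \<pi>' e = prod \<pi> e" by (intro prod.cong) (auto simp: \<pi>'_def)
              then show ?thesis using e by (auto simp: frustrated_edges_def)
            qed
          qed
          then have "card (frustrated_edges T \<sigma> \<pi>') \<le> card (insert {v, w} (frustrated_edges T \<sigma> \<pi>))"
            using fin_fr by (intro card_mono) auto
          then have "card (frustrated_edges T \<sigma> \<pi>') \<le> Suc (card (frustrated_edges T \<sigma> \<pi>))"
            using fin_fr by (simp add: card_insert_if split: if_splits)
          moreover have "\<pi>' u \<in> {1, -1}" for u using \<pi> \<tau> many by (simp add: \<pi>'_def)
          ultimately show ?thesis using M' le
            by (intro exI[of _ M] exI[of _ \<pi>']) auto
        qed
      next
        case (one w)
        define loc' where "loc' = (\<lambda>x. if loc x = v then w else loc x)"
        define \<tau>' where "\<tau>' = (\<lambda>x. if loc x = v then \<tau> x * \<sigma> {v, w} else \<tau> x)"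
        have w: "w \<in> verts T" using T(1) one by (auto simp: simple_graph_def)
        have \<sigma>vw: "\<sigma> {v, w} \<in> {1, -1}" using \<sigma> one by blast
        have less: "card (verts T') + card X < card (verts T) + card X" using card_T' by simp
        have loc': "loc' ` X \<subseteq> verts T'" using X w one T' by (auto simp: loc'_def)
        have \<tau>': "\<tau>' ` X \<subseteq> {1, -1}"
        proof (rule image_subsetI)
          show "\<tau>' x \<in> {1, -1}" if "x \<in> X" for x
            using \<tau>[OF that] \<sigma>vw by (auto simp: \<tau>'_def)
        qed
        obtain M \<pi> where M: "linkage T' \<sigma> X loc' \<tau>' M" and \<pi>: "\<And>u. \<pi> u \<in> {1, -1}"
          and le: "card (frustrated_edges T' \<sigma> \<pi>) + card (frustrated_tokens X loc' \<tau>' \<pi>) \<le> card M"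
          using less.hyps[OF less T'(1,2) \<sigma>' X(1) loc' \<tau>']
          by (elim exE conjE) (rule that, assumption, erule spec, assumption)
        \<comment> \<open>The value at \<open>v\<close> that keeps the edge \<open>{v, w}\<close>
          from being frustrated. A token at \<open>v\<close> then agrees with it exactly when the
          moved token agrees with \<open>\<pi> w\<close>.\<close>
        define \<pi>' where "\<pi>' = \<pi>(v := \<sigma> {v, w} * \<pi> w)"
        obtain N where N: "linkage T \<sigma> X loc \<tau> N" "card N = card M"
          using linkage_extend_at_leaf[OF M[unfolded T'_def loc'_def \<tau>'_def] v(1) one(1) one(3)]
          by blast
        have "edges T = insert {v, w} (edges T')"
          using T'(4) one(1) unique_edge[OF _ _ one(1)] by blast
        moreover have "\<sigma> {v, w} = prod \<pi>' {v, w}"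
          using one(2) \<pi>[of w] by (auto simp: \<pi>'_def)
        ultimately have "frustrated_edges T \<sigma> \<pi>' = frustrated_edges T' \<sigma> \<pi>'"
          by (auto simp: frustrated_edges_def)
        also have "\<dots> = frustrated_edges T' \<sigma> \<pi>"
          unfolding T'_def \<pi>'_def by (rule frustrated_edges_upd_delete_vertex)
        finally have "frustrated_edges T \<sigma> \<pi>' = frustrated_edges T' \<sigma> \<pi>" .
        moreover have "frustrated_tokens X loc \<tau> \<pi>' = frustrated_tokens X loc' \<tau>' \<pi>"
          using \<sigma>vw by (auto simp: frustrated_tokens_def \<pi>'_def loc'_def \<tau>'_def)
        moreover have "\<pi>' u \<in> {1, -1}" for u using \<pi>[of u] \<pi>[of w] \<sigma>vw by (auto simp: \<pi>'_def)
        ultimately show ?thesis using N le by metis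
      qed
    qed
  qed
  then show thesis using that by blast
qed

section \<open>Packings of negative cycles against balancing sets\<close>

text \<open>A negative cycle that missed \<open>F\<close> would survive in the balanced graph.
  Picking an edge of \<open>F\<close> from each cycle is injective, since the cycles are
  disjoint.\<close>

lemma packing_le_balancing:
  assumes "P \<subseteq> negative_cycles G \<sigma>" "pairwise disjnt P"
    and "finite F" "balanced (delete_edges G F) \<sigma>"
  shows "card P \<le> card F"
proof -
  have "\<exists>e. e \<in> C \<inter> F" if "C \<in> P" for C
  proof (rule ccontr)
    assume "\<nexists>e. e \<in> C \<inter> F"
    moreover have "C \<in> cycles G" using that assms(1) by (auto simp: negative_cycles_def)
    ultimately have "C \<in> cycles (delete_edges G F)"
      unfolding cycles_def is_cycle_def delete_edges_def by fastforce
    then have "cycle_sign \<sigma> C = 1" using assms(4) by (simp add: balanced_def)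
    then show False using that assms(1) by (auto simp: negative_cycles_def)
  qed
  then obtain f where f: "\<And>C. C \<in> P \<Longrightarrow> f C \<in> C \<inter> F" by metis
  have "inj_on f P"
    using f assms(2) unfolding inj_on_def pairwise_def disjnt_iff by (metis IntD1)
  then show ?thesis using f assms(3) by (intro card_inj_on_le[of f]) auto
qed

text \<open>Weak duality makes a packing and a balancing set of matching size certify each other's
  optimality.\<close>

lemma frustration_index_eq_packing_numberI:
  assumes "finite (edges G)"
    and P: "P \<subseteq> negative_cycles G \<sigma>" "pairwise disjnt P"
    and F: "F \<subseteq> edges G" "balanced (delete_edges G F) \<sigma>"
    and le: "card F \<le> card P"
  shows "frustration_index G \<sigma> = negative_cycle_packing_number G \<sigma>"
proof -
  have fin: "finite F'" if "F' \<subseteq> edges G" for F'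
    using that assms(1) finite_subset by blast
  have eq: "card F = card P"
    using packing_le_balancing[OF P fin[OF F(1)] F(2)] le by simp
  have "frustration_index G \<sigma> = card F"
    unfolding frustration_index_def
  proof (rule Min_eqI)
    show "finite {card F |F. F \<subseteq> edges G \<and> balanced (delete_edges G F) \<sigma>}"
      using assms(1) by (auto intro: finite_subset[of _ "card ` Pow (edges G)"])
    show "card F \<le> k" if "k \<in> {card F |F. F \<subseteq> edges G \<and> balanced (delete_edges G F) \<sigma>}" for k
      using that packing_le_balancing[OF P] fin eq by auto
  qed (use F in blast)
  moreover have "negative_cycle_packing_number G \<sigma> = card P"
    unfolding negative_cycle_packing_number_def
  proof (rule Max_eqI)
    have "card Q \<le> card F" if "Q \<subseteq> negative_cycles G \<sigma>" "pairwise disjnt Q" for Q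
      using packing_le_balancing[OF that fin[OF F(1)] F(2)] .
    then show "k \<le> card P" if "k \<in> {card P |P. P \<subseteq> negative_cycles G \<sigma> \<and> pairwise disjnt P}" for k
      using that eq by auto
    \<comment> \<open>The bound on all packing sizes just shown also gives the finiteness that
      \<open>Max\<close> requires.\<close>
    then show "finite {card P |P. P \<subseteq> negative_cycles G \<sigma> \<and> pairwise disjnt P}"
      by (meson finite_nat_set_iff_bounded_le)
  qed (use P in blast)
  ultimately show ?thesis using eq by simp
qed

section \<open>From links in the tree to cycles through the apex\<close>

theorem theorem8:
  fixes n :: nat and h :: 'a and T A :: "'a ugraph" and \<sigma> :: "'a set \<Rightarrow> int"
  assumes "apex_tree n h T A"
    and "signature A \<sigma>"
  shows "frustration_index A \<sigma> = negative_cycle_packing_number A \<sigma>"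
proof -
  have A: "simple_graph A" and h: "h \<in> verts A" and T_def: "T = delete_vertex A h"
    and T: "simple_graph T" "cycles T = {}"
    using assms(1) by (auto simp: apex_tree_def is_tree_def)
  have \<sigma>: "\<sigma> e \<in> {1, -1}" if "e \<in> edges A" for e
    using assms(2) that by (auto simp: signature_def)
  have T_simps: "verts T = verts A - {h}" "edges T = {e \<in> edges A. h \<notin> e}"
    by (auto simp: T_def delete_vertex_def)
  have finA: "finite (verts A)" using A by (simp add: simple_graph_def)
  have finE: "finite (edges A)"
    using A finA by (auto simp: simple_graph_def intro: finite_subset[of _ "Pow (verts A)"])
  \<comment> \<open>Each neighbour of \<open>h\<close> serves as its own token, so the location map
    is \<open>id\<close>, and the sign of the token is that of its edge to \<open>h\<close>.\<close>
  define X where "X = {x. {h, x} \<in> edges A}"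
  have X: "X \<subseteq> verts T" "h \<notin> X"
    using A by (auto simp: X_def T_simps simple_graph_def)
  then have finX: "finite X" using finA T_simps by (auto intro: finite_subset)
  obtain M \<pi> where M: "linkage T \<sigma> X id (\<lambda>x. \<sigma> {h, x}) M" and \<pi>: "\<And>v. \<pi> v \<in> {1, -1}"
    and le: "card (frustrated_edges T \<sigma> \<pi>) +
      card (frustrated_tokens X id (\<lambda>x. \<sigma> {h, x}) \<pi>) \<le> card M"
  proof (rule forest_linkage_min_max[OF T, of \<sigma> X id "\<lambda>x. \<sigma> {h, x}"])
    show "\<sigma> ` edges T \<subseteq> {1, -1}" "(\<lambda>x. \<sigma> {h, x}) ` X \<subseteq> {1, -1}"
      using \<sigma> by (auto simp: T_simps X_def)
  qed (use finX X in auto)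
  \<comment> \<open>Translates resources into edges of \<open>A\<close>, a token into its edge to
    \<open>h\<close>. Only edges from tokens contain \<open>h\<close>, so \<open>f\<close> is
    injective and disjoint supports become disjoint edge sets.\<close>
  define f where "f = case_sum (\<lambda>x. {h, x}) (\<lambda>e. e)"
  define cyc where "cyc = (\<lambda>(x :: 'a, p, y :: 'a). cycle_edges (h # p))"
  have inj_f: "inj_on f (Inl ` X \<union> Inr ` edges T)"
    by (auto simp: inj_on_def f_def T_simps doubleton_eq_iff)
  have cyc: "cyc m = f ` support m \<and> support m \<subseteq> Inl ` X \<union> Inr ` edges T \<and> cyc m \<in> negative_cycles A \<sigma>"
    if "m \<in> M" for m
  proof -
    obtain x p y where m: "m = (x, p, y)" by (cases m) auto
    have "negative_link T \<sigma> X id (\<lambda>x. \<sigma> {h, x}) m" using M that by (simp add: linkage_def)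
    then have l: "x \<in> X" "y \<in> X" "x \<noteq> y" "is_path T p" "hd p = x" "last p = y"
      "\<sigma> {h, x} * (\<Prod>e\<in>path_edges p. \<sigma> e) * \<sigma> {h, y} = -1"
      by (auto simp: m)
    have p: "p \<noteq> []" "distinct (h # p)" "path_edges p \<subseteq> edges T"
      using l(4) by (auto simp: is_path_def T_simps)
    \<comment> \<open>The ends of the link are distinct neighbours of \<open>h\<close>, so
      \<open>p\<close> has at least two vertices.\<close>
    have len: "length (h # p) \<ge> 3"
      using l(3,5,6) p(1) by (cases p; cases "tl p") auto
    have ce: "cycle_edges (h # p) = insert {y, h} (path_edges (h # p))"
      using cycle_edges_conv_path_edges[of "h # p"] p(1) l(6) by simp
    have "{y, h} \<notin> path_edges (h # p)"
      using closing_edge_notin_path_edges[OF p(2) len] p(1) l(6) by simp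
    then have "cycle_sign \<sigma> (cycle_edges (h # p)) = -1"
      using l(5,7) p(1,2)
      by (simp add: cycle_sign_def ce prod_path_edges_Cons insert_commute mult.commute mult.left_commute)
    moreover have "cyc m = f ` support m"
      using p(1) l(5) by (auto simp: cyc_def m ce path_edges_Cons f_def insert_commute image_iff)
    moreover have "cycle_edges (h # p) \<subseteq> edges A"
      using l(1,2,5) p(1,3) by (auto simp: ce path_edges_Cons X_def T_simps insert_commute)
    moreover have "support m \<subseteq> Inl ` X \<union> Inr ` edges T"
      using p(3) l(1,2) by (auto simp: m)
    ultimately have "cycle_edges (h # p) \<in> negative_cycles A \<sigma>"
      unfolding negative_cycles_def cycles_def is_cycle_def using p(2) len by blast
    with \<open>cyc m = f ` support m\<close> \<open>support m \<subseteq> Inl ` X \<union> Inr ` edges T\<close>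
    show ?thesis by (simp add: m cyc_def)
  qed
  have disj: "disjnt (cyc m) (cyc m')" if "m \<in> M" "m' \<in> M" "m \<noteq> m'" for m m'
  proof -
    have "disjnt (support m) (support m')"
      using M that by (auto simp: linkage_def pairwise_def)
    then show ?thesis
      using cyc[OF that(1)] cyc[OF that(2)] inj_on_image_Int[OF inj_f, of "support m" "support m'"]
      by (simp add: disjnt_def)
  qed
  \<comment> \<open>Two links with the same cycle would make it disjoint from itself, hence empty.
    So nonemptiness turns disjointness into injectivity of \<open>cyc\<close>.\<close>
  have ne: "cyc m \<noteq> {}" if "m \<in> M" for m
    using cyc[OF that] by (cases m) auto
  have "inj_on cyc M"
    using disj ne by (metis inj_onI disjnt_self_iff_empty)
  then have card_P: "card (cyc ` M) = card M" by (rule card_image)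
  define F where "F = frustrated_edges T \<sigma> \<pi> \<union>
    (\<lambda>x. {h, x}) ` frustrated_tokens X id (\<lambda>x. \<sigma> {h, x}) \<pi>"
  have "card F \<le> card (frustrated_edges T \<sigma> \<pi>) +
      card (frustrated_tokens X id (\<lambda>x. \<sigma> {h, x}) \<pi>)"
    unfolding F_def using finX
    by (intro order.trans[OF card_Un_le] add_left_mono card_image_le) (simp add: frustrated_tokens_def)
  with le card_P have "card F \<le> card (cyc ` M)" by simp
  moreover have "balanced (delete_edges A F) \<sigma>"
  \<comment> \<open>With potential 1 at \<open>h\<close>, an edge \<open>{h, x}\<close> agrees with
    the potential exactly when the token \<open>x\<close> does, so every edge that disagrees lies in
    \<open>F\<close>.\<close>
  proof (rule balanced_if_potential[of "\<pi>(h := 1)"])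
    fix e assume "e \<in> edges (delete_edges A F)"
    then have e: "e \<in> edges A" "e \<notin> F" by (auto simp: delete_edges_def)
    show "\<sigma> e = prod (\<pi>(h := 1)) e"
    proof (cases "h \<in> e")
      case True
      then obtain x where x: "e = {h, x}" "x \<noteq> h"
        using A e(1) by (auto simp: simple_graph_def card_2_iff)
      then have "\<sigma> e = \<pi> x" using e by (auto simp: F_def frustrated_tokens_def X_def)
      then show ?thesis using x by simp
    next
      case False
      then have "prod (\<pi>(h := 1)) e = prod \<pi> e" by (intro prod.cong) auto
      then show ?thesis using e False by (auto simp: F_def frustrated_edges_def T_simps)
    qed
  qed (use \<pi> in simp)
  moreover have "F \<subseteq> edges A"
    by (auto simp: F_def frustrated_edges_def frustrated_tokens_def T_simps X_def)
  moreover have "pairwise disjnt (cyc ` M)"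
    using disj by (intro pairwise_imageI) blast
  moreover have "cyc ` M \<subseteq> negative_cycles A \<sigma>" using cyc by blast
  ultimately show ?thesis
    by (intro frustration_index_eq_packing_numberI[OF finE])
qed

end
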